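(* The proof system $\mathsf{SDELKh}$ is sound over the class of all models: for every formula $\varphi\in\mathbf{DELKh}$, if $\varphi$ is provable in $\mathsf{SDELKh}$ then $M,w\vDash\varphi$ for every model $M$ and every world $w$ of $M$.
   Context: Fix a countable set $\mathbf{P}$ of proposition letters. $\mathbf{PL}$: $\alpha::=p\mid\bot\mid(\alpha\land\alpha)\mid(\alpha\lor\alpha)\mid(\alpha\to\alpha)$, $p\in\mathbf{P}$. $\mathbf{DELKh}$: $\varphi::=p\mid\bot\mid(\varphi\land\varphi)\mid(\varphi\lor\varphi)\mid(\varphi\to\varphi)\mid\mathsf{K}\varphi\mid\mathsf{Kh}\alpha\mid\Box\varphi$, with $p\in\mathbf{P}$, $\alpha\in\mathbf{PL}$. Abbreviations: $\neg\varphi:=\varphi\to\bot$, $\varphi\leftrightarrow\psi:=(\varphi\to\psi)\land(\psi\to\varphi)$, $\widehat{\mathsf{K}}:=\neg\mathsf{K}\neg$, $\Diamond:=\neg\Box\neg$. A model (epistemic model) is $M=\langle W,V\rangle$ with $W\ne\varnothing$ and $V:W\to\wp(\mathbf{P})$. A submodel of $M$ is $\langle W',V|_{W'}\rangle$ with $\varnothing\ne W'\subseteq W$. Resolution space: $S(p)=\{p\}$; $S(\bot)=\{\bot\}$; $S(\alpha\lor\beta)=(S(\alpha)\times\{0\})\cup(S(\beta)\times\{1\})$; $S(\alpha\land\beta)=S(\alpha)\times S(\beta)$; $S(\alpha\to\beta)=S(\beta)^{S(\alpha)}$. Resolutions at $w\in W$: $R(w,\bot)=\varnothing$; $R(w,p)=\{p\}$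 if $p\in V(w)$, else $\varnothing$; $R(w,\alpha\lor\beta)=(R(w,\alpha)\times\{0\})\cup(R(w,\beta)\times\{1\})$; $R(w,\alpha\land\beta)=R(w,\alpha)\times R(w,\beta)$; $R(w,\alpha\to\beta)=\{f\in S(\beta)^{S(\alpha)}\mid f[R(w,\alpha)]\subseteq R(w,\beta)\}$. Satisfaction $M,w\vDash\varphi$: $M,w\nvDash\bot$; $M,w\vDash p$ iff $p\in V(w)$; $\land,\lor,\to$ are classical; $M,w\vDash\Box\varphi$ iff $M',w\vDash\varphi$ for every submodel $M'$ of $M$ containing $w$; $M,w\vDash\mathsf{K}\varphi$ iff $M,v\vDash\varphi$ for all $v\in W$; $M,w\vDash\mathsf{Kh}\alpha$ iff there is $x\in S(\alpha)$ with $x\in R(v,\alpha)$ for all $v\in W$. System $\mathsf{SDELKh}$ ($p\in\mathbf{P}$; $\alpha,\beta,\alpha_i\in\mathbf{PL}$; $\varphi,\psi\in\mathbf{DELKh}$). Axioms: all (instances in $\mathbf{DELKh}$ of) propositional tautologies; $\mathsf{K}(\varphi\to\psi)\to(\mathsf{K}\varphi\to\mathsf{K}\psi)$; $\mathsf{K}\varphi\to\varphi$; $\mathsf{K}\varphi\to\mathsf{K}\mathsf{K}\varphi$; $\neg\mathsf{K}\varphi\to\mathsf{K}\neg\mathsf{K}\varphi$; $\Box(\varphi\to\psi)\to(\Box\varphi\to\Box\psi)$; $\Box\varphi\to\varphi$; $\Box\varphi\to\Box\Box\varphi$; $\mathsf{K}\Box\varphi\to\Box\mathsf{K}\varphi$;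 $\alpha\to\Box\alpha$; $\alpha\to\Diamond\mathsf{Kh}\alpha$; $\mathsf{Kh}\alpha\to\mathsf{K}\alpha$; $\mathsf{K}p\to\mathsf{Kh}p$; $\mathsf{Kh}\bot\leftrightarrow\bot$; $\mathsf{Kh}(\alpha\lor\beta)\leftrightarrow\mathsf{Kh}\alpha\lor\mathsf{Kh}\beta$; $\mathsf{Kh}(\alpha\land\beta)\leftrightarrow\mathsf{Kh}\alpha\land\mathsf{Kh}\beta$; $\mathsf{Kh}(\alpha\to\beta)\leftrightarrow\mathsf{K}\Box(\mathsf{Kh}\alpha\to\mathsf{Kh}\beta)$; $\mathsf{Kh}\alpha\to\mathsf{K}\mathsf{Kh}\alpha$; $\neg\mathsf{Kh}\alpha\to\mathsf{K}\neg\mathsf{Kh}\alpha$; and for each $k\in\mathbb{N}$, $\alpha\land\bigwedge_{1\le i\le k}\widehat{\mathsf{K}}(\alpha\land\alpha_i)\to\Diamond(\mathsf{K}\alpha\land\bigwedge_{1\le i\le k}\widehat{\mathsf{K}}\alpha_i)$. Rules: modus ponens; from $\vdash\varphi$ infer $\vdash\mathsf{K}\varphi$; from $\vdash\varphi$ infer $\vdash\Box\varphi$. *)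

theory Defs
  imports Main "HOL-Library.Countable" "HOL-Library.FSet" "HOL-Library.FuncSet"
begin

datatype 'p pl =
    PAtom 'p
  | PBot
  | PAnd "'p pl" "'p pl"
  | POr "'p pl" "'p pl"
  | PImp "'p pl" "'p pl"

datatype 'p form =
    Atom 'p
  | Bot
  | And "'p form" "'p form" (infixr "\<^bold>\<and>" 65)
  | Or "'p form" "'p form" (infixr "\<^bold>\<or>" 60)
  | Imp "'p form" "'p form" (infixr "\<^bold>\<longrightarrow>" 55)
  | K "'p form"
  | Kh "'p pl"
  | Box "'p form"

abbreviation Neg :: "'p form \<Rightarrow> 'p form" ("\<^bold>\<not> _" [70] 70)
  where "\<^bold>\<not> \<phi> \<equiv> \<phi> \<^bold>\<longrightarrow> Bot"

abbreviation Iff :: "'p form \<Rightarrow> 'p form \<Rightarrow> 'p form" (infix "\<^bold>\<longleftrightarrow>" 54)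
  where "\<phi> \<^bold>\<longleftrightarrow> \<psi> \<equiv> (\<phi> \<^bold>\<longrightarrow> \<psi>) \<^bold>\<and> (\<psi> \<^bold>\<longrightarrow> \<phi>)"

abbreviation Khat :: "'p form \<Rightarrow> 'p form"
  where "Khat \<phi> \<equiv> \<^bold>\<not> (K (\<^bold>\<not> \<phi>))"

abbreviation Dia :: "'p form \<Rightarrow> 'p form"
  where "Dia \<phi> \<equiv> \<^bold>\<not> (Box (\<^bold>\<not> \<phi>))"

fun bigconj :: "'p form list \<Rightarrow> 'p form" where
  "bigconj [] = \<^bold>\<not> Bot"
| "bigconj [\<phi>] = \<phi>"
| "bigconj (\<phi> # \<psi> # \<phi>s) = \<phi> \<^bold>\<and> bigconj (\<psi> # \<phi>s)"

primrec subst :: "('a \<Rightarrow> 'p form) \<Rightarrow> 'a pl \<Rightarrow> 'p form" where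
  "subst \<sigma> (PAtom a) = \<sigma> a"
| "subst \<sigma> PBot = Bot"
| "subst \<sigma> (PAnd \<alpha> \<beta>) = subst \<sigma> \<alpha> \<^bold>\<and> subst \<sigma> \<beta>"
| "subst \<sigma> (POr \<alpha> \<beta>) = subst \<sigma> \<alpha> \<^bold>\<or> subst \<sigma> \<beta>"
| "subst \<sigma> (PImp \<alpha> \<beta>) = subst \<sigma> \<alpha> \<^bold>\<longrightarrow> subst \<sigma> \<beta>"

text \<open>The inclusion of propositional formulas into the full language.\<close>

abbreviation emb :: "'p pl \<Rightarrow> 'p form"
  where "emb \<alpha> \<equiv> subst Atom \<alpha>"

text \<open>Resolutions. A function between resolution spaces is encoded by its graph; graphs are
  finite because every resolution space is finite, see \<open>finite_S\<close> and \<open>bij_betw_S_PImp\<close>.\<close>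

datatype 'p res =
    ResAtom 'p
  | ResBot
  | ResTag "'p res" nat
  | ResPair "'p res" "'p res"
  | ResFun "('p res \<times> 'p res) fset"

primrec S :: "'p pl \<Rightarrow> 'p res set" where
  "S (PAtom p) = {ResAtom p}"
| "S PBot = {ResBot}"
| "S (PAnd \<alpha> \<beta>) = {ResPair x y | x y. x \<in> S \<alpha> \<and> y \<in> S \<beta>}"
| "S (POr \<alpha> \<beta>) = {ResTag x 0 | x. x \<in> S \<alpha>} \<union> {ResTag y 1 | y. y \<in> S \<beta>}"
| "S (PImp \<alpha> \<beta>) =
     {ResFun f | f. fset f \<subseteq> S \<alpha> \<times> S \<beta> \<and> (\<forall>x\<in>S \<alpha>. \<exists>!y. (x, y) \<in> fset f)}"

text \<open>\<open>val M\<close> is only meaningful on \<open>worlds M\<close>. Accordingly, that a submodel carries the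
  restricted valuation means that the two valuations agree on the worlds of the submodel.\<close>

record ('w, 'p) model =
  worlds :: "'w set"
  val :: "'w \<Rightarrow> 'p set"

definition is_model :: "('w, 'p) model \<Rightarrow> bool" where
  "is_model M \<longleftrightarrow> worlds M \<noteq> {}"

definition submodel :: "('w, 'p) model \<Rightarrow> ('w, 'p) model \<Rightarrow> bool" where
  "submodel M' M \<longleftrightarrow> worlds M' \<noteq> {} \<and> worlds M' \<subseteq> worlds M \<and>
     (\<forall>w\<in>worlds M'. val M' w = val M w)"

primrec R :: "('w, 'p) model \<Rightarrow> 'w \<Rightarrow> 'p pl \<Rightarrow> 'p res set" where
  "R M w (PAtom p) = (if p \<in> val M w then {ResAtom p} else {})"
| "R M w PBot = {}"
| "R M w (PAnd \<alpha> \<beta>) = {ResPair x y | x y. x \<in> R M w \<alpha> \<and> y \<in> R M w \<beta>}"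
| "R M w (POr \<alpha> \<beta>) = {ResTag x 0 | x. x \<in> R M w \<alpha>} \<union> {ResTag y 1 | y. y \<in> R M w \<beta>}"
| "R M w (PImp \<alpha> \<beta>) =
     {ResFun f | f. ResFun f \<in> S (PImp \<alpha> \<beta>) \<and> fset f `` R M w \<alpha> \<subseteq> R M w \<beta>}"

primrec sat :: "'p form \<Rightarrow> ('w, 'p) model \<Rightarrow> 'w \<Rightarrow> bool" where
  "sat (Atom p) M w \<longleftrightarrow> p \<in> val M w"
| "sat Bot M w \<longleftrightarrow> False"
| "sat (\<phi> \<^bold>\<and> \<psi>) M w \<longleftrightarrow> sat \<phi> M w \<and> sat \<psi> M w"
| "sat (\<phi> \<^bold>\<or> \<psi>) M w \<longleftrightarrow> sat \<phi> M w \<or> sat \<psi> M w"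
| "sat (\<phi> \<^bold>\<longrightarrow> \<psi>) M w \<longleftrightarrow> (sat \<phi> M w \<longrightarrow> sat \<psi> M w)"
| "sat (K \<phi>) M w \<longleftrightarrow> (\<forall>v\<in>worlds M. sat \<phi> M v)"
| "sat (Kh \<alpha>) M w \<longleftrightarrow> (\<exists>x\<in>S \<alpha>. \<forall>v\<in>worlds M. x \<in> R M v \<alpha>)"
| "sat (Box \<phi>) M w \<longleftrightarrow> (\<forall>M'. submodel M' M \<and> w \<in> worlds M' \<longrightarrow> sat \<phi> M' w)"

primrec pl_eval :: "('a \<Rightarrow> bool) \<Rightarrow> 'a pl \<Rightarrow> bool" where
  "pl_eval v (PAtom a) \<longleftrightarrow> v a"
| "pl_eval v PBot \<longleftrightarrow> False"
| "pl_eval v (PAnd \<alpha> \<beta>) \<longleftrightarrow> pl_eval v \<alpha> \<and> pl_eval v \<beta>"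
| "pl_eval v (POr \<alpha> \<beta>) \<longleftrightarrow> pl_eval v \<alpha> \<or> pl_eval v \<beta>"
| "pl_eval v (PImp \<alpha> \<beta>) \<longleftrightarrow> (pl_eval v \<alpha> \<longrightarrow> pl_eval v \<beta>)"

definition tautology :: "'a pl \<Rightarrow> bool" where
  "tautology \<tau> \<longleftrightarrow> (\<forall>v. pl_eval v \<tau>)"

text \<open>In rule \<open>Taut\<close> the schematic letters are natural numbers, so that there are enough of them
  even when \<open>'p\<close> is finite.\<close>

inductive SDELKh :: "'p form \<Rightarrow> bool" ("\<turnstile> _" [50] 50) where
  Taut: "tautology (\<tau> :: nat pl) \<Longrightarrow> \<turnstile> subst \<sigma> \<tau>"
| DistK: "\<turnstile> K (\<phi> \<^bold>\<longrightarrow> \<psi>) \<^bold>\<longrightarrow> (K \<phi> \<^bold>\<longrightarrow> K \<psi>)"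
| TK: "\<turnstile> K \<phi> \<^bold>\<longrightarrow> \<phi>"
| FourK: "\<turnstile> K \<phi> \<^bold>\<longrightarrow> K (K \<phi>)"
| FiveK: "\<turnstile> \<^bold>\<not> (K \<phi>) \<^bold>\<longrightarrow> K (\<^bold>\<not> (K \<phi>))"
| DistBox: "\<turnstile> Box (\<phi> \<^bold>\<longrightarrow> \<psi>) \<^bold>\<longrightarrow> (Box \<phi> \<^bold>\<longrightarrow> Box \<psi>)"
| TBox: "\<turnstile> Box \<phi> \<^bold>\<longrightarrow> \<phi>"
| FourBox: "\<turnstile> Box \<phi> \<^bold>\<longrightarrow> Box (Box \<phi>)"
| KBox: "\<turnstile> K (Box \<phi>) \<^bold>\<longrightarrow> Box (K \<phi>)"
| Per: "\<turnstile> emb \<alpha> \<^bold>\<longrightarrow> Box (emb \<alpha>)"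
| DiaKh: "\<turnstile> emb \<alpha> \<^bold>\<longrightarrow> Dia (Kh \<alpha>)"
| KhK: "\<turnstile> Kh \<alpha> \<^bold>\<longrightarrow> K (emb \<alpha>)"
| KKhAtom: "\<turnstile> K (Atom p) \<^bold>\<longrightarrow> Kh (PAtom p)"
| KhBot: "\<turnstile> Kh PBot \<^bold>\<longleftrightarrow> Bot"
| KhOr: "\<turnstile> Kh (POr \<alpha> \<beta>) \<^bold>\<longleftrightarrow> (Kh \<alpha> \<^bold>\<or> Kh \<beta>)"
| KhAnd: "\<turnstile> Kh (PAnd \<alpha> \<beta>) \<^bold>\<longleftrightarrow> (Kh \<alpha> \<^bold>\<and> Kh \<beta>)"
| KhImp: "\<turnstile> Kh (PImp \<alpha> \<beta>) \<^bold>\<longleftrightarrow> K (Box (Kh \<alpha> \<^bold>\<longrightarrow> Kh \<beta>))"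
| FourKh: "\<turnstile> Kh \<alpha> \<^bold>\<longrightarrow> K (Kh \<alpha>)"
| FiveKh: "\<turnstile> \<^bold>\<not> (Kh \<alpha>) \<^bold>\<longrightarrow> K (\<^bold>\<not> (Kh \<alpha>))"
| Upd: "\<turnstile> (emb \<alpha> \<^bold>\<and> bigconj (map (\<lambda>\<beta>. Khat (emb \<alpha> \<^bold>\<and> emb \<beta>)) \<alpha>s)) \<^bold>\<longrightarrow>
          Dia (K (emb \<alpha>) \<^bold>\<and> bigconj (map (\<lambda>\<beta>. Khat (emb \<beta>)) \<alpha>s))"
| MP: "\<turnstile> \<phi> \<Longrightarrow> \<turnstile> \<phi> \<^bold>\<longrightarrow> \<psi> \<Longrightarrow> \<turnstile> \<psi>"
| NecK: "\<turnstile> \<phi> \<Longrightarrow> \<turnstile> K \<phi>"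
| NecBox: "\<turnstile> \<phi> \<Longrightarrow> \<turnstile> Box \<phi>"

lemma finite_S: "finite (S \<alpha>)"
proof (induction \<alpha>)
  case (PAnd \<alpha> \<beta>)
  have "S (PAnd \<alpha> \<beta>) = (\<lambda>(x, y). ResPair x y) ` (S \<alpha> \<times> S \<beta>)" by auto
  then show ?case using PAnd by simp
next
  case (PImp \<alpha> \<beta>)
  have "S (PImp \<alpha> \<beta>) \<subseteq> (\<lambda>G. ResFun (Abs_fset G)) ` Pow (S \<alpha> \<times> S \<beta>)"
  proof
    fix r assume "r \<in> S (PImp \<alpha> \<beta>)"
    then obtain f where "r = ResFun f" "fset f \<subseteq> S \<alpha> \<times> S \<beta>"
      unfolding S.simps mem_Collect_eq by (elim exE conjE)
    then show "r \<in> (\<lambda>G. ResFun (Abs_fset G)) ` Pow (S \<alpha> \<times> S \<beta>)"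
      by (intro image_eqI[where x = "fset f"]) (simp_all add: fset_inverse)
  qed
  moreover have "finite ((\<lambda>G. ResFun (Abs_fset G)) ` Pow (S \<alpha> \<times> S \<beta>))"
    using PImp by simp
  ultimately show ?case by (rule finite_subset)
next
  case (POr \<alpha> \<beta>)
  have "S (POr \<alpha> \<beta>) = (\<lambda>x. ResTag x 0) ` S \<alpha> \<union> (\<lambda>y. ResTag y 1) ` S \<beta>"
    unfolding S.simps by blast
  then show ?case using POr by simp
qed simp_all

lemma bij_betw_S_PImp:
  "bij_betw (\<lambda>f. ResFun (Abs_fset ((\<lambda>x. (x, f x)) ` S \<alpha>))) (S \<alpha> \<rightarrow>\<^sub>E S \<beta>) (S (PImp \<alpha> \<beta>))"
proof -
  let ?G = "\<lambda>f. Abs_fset ((\<lambda>x. (x, f x)) ` S \<alpha>)"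
  have G: "fset (?G f) = (\<lambda>x. (x, f x)) ` S \<alpha>" for f :: "'a res \<Rightarrow> 'a res"
    by (rule Abs_fset_inverse) (simp add: finite_S)
  show ?thesis
  proof (rule bij_betw_imageI)
    show "inj_on (\<lambda>f. ResFun (?G f)) (S \<alpha> \<rightarrow>\<^sub>E S \<beta>)"
    proof (rule inj_onI)
      fix f g assume fg: "f \<in> S \<alpha> \<rightarrow>\<^sub>E S \<beta>" "g \<in> S \<alpha> \<rightarrow>\<^sub>E S \<beta>"
        and fg_eq: "ResFun (?G f) = ResFun (?G g)"
      have "?G f = ?G g" using fg_eq unfolding res.inject .
      then have "fset (?G f) = fset (?G g)"
        by (rule arg_cong)
      then have eq: "(\<lambda>x. (x, f x)) ` S \<alpha> = (\<lambda>x. (x, g x)) ` S \<alpha>"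
        unfolding G .
      show "f = g"
      proof (rule PiE_ext[OF fg])
        fix x assume "x \<in> S \<alpha>"
        then have "(x, f x) \<in> (\<lambda>x. (x, g x)) ` S \<alpha>"
          unfolding eq[symmetric] by (rule imageI)
        then show "f x = g x" by auto
      qed
    qed
    show "(\<lambda>f. ResFun (?G f)) ` (S \<alpha> \<rightarrow>\<^sub>E S \<beta>) = S (PImp \<alpha> \<beta>)"
    proof
      show "(\<lambda>f. ResFun (?G f)) ` (S \<alpha> \<rightarrow>\<^sub>E S \<beta>) \<subseteq> S (PImp \<alpha> \<beta>)"
      proof
        fix r assume "r \<in> (\<lambda>f. ResFun (?G f)) ` (S \<alpha> \<rightarrow>\<^sub>E S \<beta>)"
        then obtain f where f: "f \<in> S \<alpha> \<rightarrow>\<^sub>E S \<beta>" and r: "r = ResFun (?G f)" by blast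
        have "fset (?G f) \<subseteq> S \<alpha> \<times> S \<beta>" unfolding G using PiE_mem[OF f] by auto
        moreover have "\<forall>x\<in>S \<alpha>. \<exists>!y. (x, y) \<in> fset (?G f)"
          unfolding G by auto
        ultimately show "r \<in> S (PImp \<alpha> \<beta>)"
          unfolding r S.simps mem_Collect_eq by (intro exI conjI) (rule refl)
      qed
      show "S (PImp \<alpha> \<beta>) \<subseteq> (\<lambda>f. ResFun (?G f)) ` (S \<alpha> \<rightarrow>\<^sub>E S \<beta>)"
      proof
        fix r assume "r \<in> S (PImp \<alpha> \<beta>)"
        then obtain g where r: "r = ResFun g" and sub: "fset g \<subseteq> S \<alpha> \<times> S \<beta>"
          and ex: "\<forall>x\<in>S \<alpha>. \<exists>!y. (x, y) \<in> fset g"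
          unfolding S.simps mem_Collect_eq by (elim exE conjE)
        define f where "f = restrict (\<lambda>x. THE y. (x, y) \<in> fset g) (S \<alpha>)"
        have f: "(x, f x) \<in> fset g" if "x \<in> S \<alpha>" for x
          using theI'[OF bspec[OF ex that]] that by (simp add: f_def)
        have fE: "f \<in> S \<alpha> \<rightarrow>\<^sub>E S \<beta>"
        proof (rule PiE_I)
          show "f x \<in> S \<beta>" if "x \<in> S \<alpha>" for x using f[OF that] sub by blast
        qed (simp add: f_def)
        have "fset g = (\<lambda>x. (x, f x)) ` S \<alpha>"
        proof
          show "fset g \<subseteq> (\<lambda>x. (x, f x)) ` S \<alpha>"
          proof (rule subrelI)
            fix x y assume xy: "(x, y) \<in> fset g"
            then have x: "x \<in> S \<alpha>" using sub by blast
            then have "y = f x" using the1_equality[OF bspec[OF ex x] xy] by (simp add: f_def)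
            then show "(x, y) \<in> (\<lambda>x. (x, f x)) ` S \<alpha>" using x by blast
          qed
        qed (use f in blast)
        then have gG: "g = ?G f" unfolding fset_inject[symmetric] G .
        show "r \<in> (\<lambda>f. ResFun (?G f)) ` (S \<alpha> \<rightarrow>\<^sub>E S \<beta>)"
          unfolding r gG by (rule image_eqI[where x = f, OF refl fE])
      qed
    qed
  qed
qed

end

theory Submission
  imports Defs
begin

text \<open>By induction on derivations. Two facts carry the argument: \<open>R M w \<alpha>\<close> is nonempty exactly
  when \<open>\<alpha>\<close> is true at \<open>w\<close>, and whether \<open>Kh (PImp \<alpha> \<beta>)\<close> holds can be tested on the submodels
  \<open>{v. x \<in> R M v \<alpha>}\<close>, one for each \<open>x \<in> S \<alpha>\<close>: a resolution of \<open>\<beta>\<close> known in each of them is the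
  value at \<open>x\<close> of a resolution of the implication.\<close>

text \<open>Supplies default values: a resolution of an implication must be defined on all of
  \<open>S \<alpha>\<close>, also at arguments where nothing is required of its value.\<close>

lemma S_nonempty: "S \<alpha> \<noteq> {}"
proof (induction \<alpha>)
  case (PImp \<alpha> \<beta>)
  then show ?case
    using bij_betw_S_PImp[of \<alpha> \<beta>] by (auto simp: bij_betw_def PiE_eq_empty_iff simp del: S.simps)
qed auto

text \<open>Turns a function into an encoded resolution. Only the values of \<open>g\<close> on the
  finite set \<open>S \<alpha>\<close> enter the graph, so \<open>g\<close> may be arbitrary
  elsewhere.\<close>

lemma S_PImp_graph:
  assumes "g \<in> S \<alpha> \<rightarrow> S \<beta>"
  obtains f where "ResFun f \<in> S (PImp \<alpha> \<beta>)" "fset f = (\<lambda>x. (x, g x)) ` S \<alpha>"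
proof
  let ?f = "Abs_fset ((\<lambda>x. (x, g x)) ` S \<alpha>)"
  show graph: "fset ?f = (\<lambda>x. (x, g x)) ` S \<alpha>"
    by (rule Abs_fset_inverse) (simp add: finite_S)
  show "ResFun ?f \<in> S (PImp \<alpha> \<beta>)"
    using assms by (auto simp: graph)
qed

lemma R_subset_S: "R M w \<alpha> \<subseteq> S \<alpha>"
  by (induction \<alpha>) auto

text \<open>The recursion for \<open>R\<close> never leaves the world \<open>w\<close>, so
  resolutions survive the passage to a submodel.\<close>

lemma R_cong: "val M w = val M' w \<Longrightarrow> R M w \<alpha> = R M' w \<alpha>"
  by (induction \<alpha>) simp_all

lemma sat_emb_cong: "val M w = val M' w \<Longrightarrow> sat (emb \<alpha>) M w \<longleftrightarrow> sat (emb \<alpha>) M' w"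
  by (induction \<alpha>) simp_all

lemma sat_emb_iff_R_nonempty: "sat (emb \<alpha>) M w \<longleftrightarrow> R M w \<alpha> \<noteq> {}"
proof (induction \<alpha>)
  case (PImp \<alpha> \<beta>)
  have "R M w (PImp \<alpha> \<beta>) \<noteq> {}" if cond: "R M w \<alpha> = {} \<or> R M w \<beta> \<noteq> {}"
  proof -
    \<comment> \<open>The constant function with value \<open>y\<close> will be the resolution. If
      \<open>\<alpha>\<close> has no resolution at \<open>w\<close>, any \<open>y\<close> in
      \<open>S \<beta>\<close> serves.\<close>
    obtain y where y: "y \<in> S \<beta>" "R M w \<alpha> = {} \<or> y \<in> R M w \<beta>"
      using cond S_nonempty[of \<beta>] R_subset_S[of M w \<beta>] by blast
    obtain f where "ResFun f \<in> S (PImp \<alpha> \<beta>)" "fset f = (\<lambda>x. (x, y)) ` S \<alpha>"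
      using S_PImp_graph[of "\<lambda>_. y" \<alpha> \<beta>] y by blast
    then have "ResFun f \<in> R M w (PImp \<alpha> \<beta>)"
      using y by (auto simp del: S.simps)
    then show ?thesis by blast
  qed
  \<comment> \<open>Since \<open>f\<close> is total on \<open>S \<alpha>\<close>, it has a value at
    \<open>x\<close>, and this value resolves \<open>\<beta>\<close>.\<close>
  moreover have "R M w \<beta> \<noteq> {}" if "ResFun f \<in> R M w (PImp \<alpha> \<beta>)" "x \<in> R M w \<alpha>" for f x
    using that R_subset_S[of M w \<alpha>] by auto blast
  moreover have "\<exists>f. r = ResFun f" if "r \<in> R M w (PImp \<alpha> \<beta>)" for r
    using that by auto
  ultimately have "R M w (PImp \<alpha> \<beta>) \<noteq> {} \<longleftrightarrow> R M w \<alpha> = {} \<or> R M w \<beta> \<noteq> {}"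
    by blast
  then show ?case
    using PImp by (simp del: R.simps) blast
qed auto

lemma sat_subst: "sat (subst \<sigma> \<tau>) M w \<longleftrightarrow> pl_eval (\<lambda>a. sat (\<sigma> a) M w) \<tau>"
  by (induction \<tau>) simp_all

lemma sat_bigconj: "sat (bigconj \<phi>s) M w \<longleftrightarrow> (\<forall>\<phi>\<in>set \<phi>s. sat \<phi> M w)"
  by (induction \<phi>s rule: bigconj.induct) auto

lemma submodel_refl: "w \<in> worlds M \<Longrightarrow> submodel M M"
  by (auto simp: submodel_def)

lemma submodel_trans: "submodel M'' M' \<Longrightarrow> submodel M' M \<Longrightarrow> submodel M'' M"
  by (auto simp: submodel_def)

lemma submodel_restrict:
  "w \<in> worlds M \<Longrightarrow> P w \<Longrightarrow> submodel (M\<lparr>worlds := {v \<in> worlds M. P v}\<rparr>) M"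
  by (auto simp: submodel_def)

lemma R_submodel: "submodel M' M \<Longrightarrow> v \<in> worlds M' \<Longrightarrow> R M' v \<alpha> = R M v \<alpha>"
  by (rule R_cong) (simp add: submodel_def)

lemma sat_emb_submodel:
  "submodel M' M \<Longrightarrow> v \<in> worlds M' \<Longrightarrow> sat (emb \<alpha>) M' v \<longleftrightarrow> sat (emb \<alpha>) M v"
  by (rule sat_emb_cong) (simp add: submodel_def)

lemma sat_Dia:
  "sat (Dia \<phi>) M w \<longleftrightarrow> (\<exists>M'. submodel M' M \<and> w \<in> worlds M' \<and> sat \<phi> M' w)"
  by auto

text \<open>In the submodel whose only world is \<open>w\<close>, any resolution of
  \<open>\<alpha>\<close> at \<open>w\<close> is a uniform one.\<close>

lemma sat_Dia_Kh:
  assumes "w \<in> worlds M" "sat (emb \<alpha>) M w"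
  shows "sat (Dia (Kh \<alpha>)) M w"
proof -
  let ?M' = "M\<lparr>worlds := {v \<in> worlds M. v = w}\<rparr>"
  have sub: "submodel ?M' M" and w: "w \<in> worlds ?M'"
    using assms submodel_restrict[of w M "\<lambda>v. v = w"] by auto
  obtain x where "x \<in> R ?M' w \<alpha>"
    using assms R_submodel[OF sub w] by (auto simp: sat_emb_iff_R_nonempty)
  then have "sat (Kh \<alpha>) ?M' w"
    using R_subset_S by fastforce
  then show ?thesis
    unfolding sat_Dia using sub w by blast
qed

lemma sat_Kh_imp_K:
  assumes "sat (Kh \<alpha>) M w"
  shows "sat (K (emb \<alpha>)) M w"
  using assms by (auto simp: sat_emb_iff_R_nonempty)

lemma sat_Kh_PAnd: "sat (Kh (PAnd \<alpha> \<beta>)) M w \<longleftrightarrow> sat (Kh \<alpha>) M w \<and> sat (Kh \<beta>) M w"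
proof
  assume "sat (Kh \<alpha>) M w \<and> sat (Kh \<beta>) M w"
  then obtain x y where "x \<in> S \<alpha>" "y \<in> S \<beta>" "\<forall>v\<in>worlds M. x \<in> R M v \<alpha> \<and> y \<in> R M v \<beta>"
    by auto
  then have "ResPair x y \<in> S (PAnd \<alpha> \<beta>)" "\<forall>v\<in>worlds M. ResPair x y \<in> R M v (PAnd \<alpha> \<beta>)"
    by auto
  then show "sat (Kh (PAnd \<alpha> \<beta>)) M w"
    unfolding sat.simps by blast
qed auto

text \<open>A uniform resolution carries one tag, the same at all worlds, and this tag selects the
  disjunct.\<close>

lemma sat_Kh_POr:
  assumes "w \<in> worlds M"
  shows "sat (Kh (POr \<alpha> \<beta>)) M w \<longleftrightarrow> sat (Kh \<alpha>) M w \<or> sat (Kh \<beta>) M w"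
proof
  assume "sat (Kh \<alpha>) M w \<or> sat (Kh \<beta>) M w"
  then show "sat (Kh (POr \<alpha> \<beta>)) M w"
    by (auto intro: exI[of _ "ResTag _ _"])
qed (use assms in auto)

lemma sat_Kh_PImp:
  assumes "w \<in> worlds M"
  shows "sat (Kh (PImp \<alpha> \<beta>)) M w \<longleftrightarrow> sat (K (Box (Kh \<alpha> \<^bold>\<longrightarrow> Kh \<beta>))) M w"
proof
  assume "sat (Kh (PImp \<alpha> \<beta>)) M w"
  then obtain r where r: "r \<in> S (PImp \<alpha> \<beta>)" "\<forall>v\<in>worlds M. r \<in> R M v (PImp \<alpha> \<beta>)"
    unfolding sat.simps by blast
  then obtain f where f: "fset f \<subseteq> S \<alpha> \<times> S \<beta>" "\<forall>x\<in>S \<alpha>. \<exists>!y. (x, y) \<in> fset f"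
    "\<forall>v\<in>worlds M. fset f `` R M v \<alpha> \<subseteq> R M v \<beta>"
    by auto
  have "sat (Kh \<beta>) M' v" if sub: "submodel M' M" and Kh: "sat (Kh \<alpha>) M' v" for M' v
  proof -
    obtain x where x: "x \<in> S \<alpha>" "\<forall>u\<in>worlds M'. x \<in> R M' u \<alpha>"
      using Kh by auto
    \<comment> \<open>The value of \<open>f\<close> at the uniform resolution \<open>x\<close> is a
      uniform resolution of \<open>\<beta>\<close> on the submodel, where resolutions are the same
      as in \<open>M\<close>.\<close>
    obtain y where y: "(x, y) \<in> fset f" "y \<in> S \<beta>"
      using f x by blast
    have "y \<in> R M' u \<beta>" if u: "u \<in> worlds M'" for u
    proof -
      have "u \<in> worlds M"
        using sub u by (auto simp: submodel_def)
      then show ?thesis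
        using f(3) bspec[OF x(2) u] y(1) unfolding R_submodel[OF sub u] by blast
    qed
    then show ?thesis
      using y by auto
  qed
  then show "sat (K (Box (Kh \<alpha> \<^bold>\<longrightarrow> Kh \<beta>))) M w"
    unfolding sat.simps by blast
next
  assume known: "sat (K (Box (Kh \<alpha> \<^bold>\<longrightarrow> Kh \<beta>))) M w"
  have "\<exists>y\<in>S \<beta>. \<forall>v\<in>worlds M. x \<in> R M v \<alpha> \<longrightarrow> y \<in> R M v \<beta>" if x: "x \<in> S \<alpha>" for x
  proof (cases "\<exists>v\<in>worlds M. x \<in> R M v \<alpha>")
    case True
    then obtain v where v: "v \<in> worlds M" "x \<in> R M v \<alpha>" by blast
    let ?M' = "M\<lparr>worlds := {v \<in> worlds M. x \<in> R M v \<alpha>}\<rparr>"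
    have sub: "submodel ?M' M"
      using submodel_restrict[of v M "\<lambda>v. x \<in> R M v \<alpha>"] v by blast
    have v_in: "v \<in> worlds ?M'"
      using v by simp
    have "sat (Kh \<alpha>) ?M' v"
      using x R_submodel[OF sub] by auto
    moreover have "sat (Kh \<alpha> \<^bold>\<longrightarrow> Kh \<beta>) ?M' v"
      \<comment> \<open>\<open>K\<close> leads to the world \<open>v\<close> and \<open>Box\<close>
        to the submodel \<open>?M'\<close>, on which \<open>x\<close> itself witnesses
        \<open>Kh \<alpha>\<close>.\<close>
      using known[unfolded sat.simps(6,8), rule_format, OF v(1) conjI[OF sub v_in]] .
    ultimately have "sat (Kh \<beta>) ?M' v"
      by (simp only: sat.simps)
    then show ?thesis
      using R_submodel[OF sub] by auto
  next
    \<comment> \<open>No world has \<open>x\<close> as a resolution, so every element of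
      \<open>S \<beta>\<close> is an admissible value.\<close>
    case False
    then show ?thesis
      using S_nonempty[of \<beta>] by blast
  qed
  \<comment> \<open>Choosing a value separately for each \<open>x\<close> gives one function that
    works at all worlds at once.\<close>
  then obtain g where g: "\<And>x. x \<in> S \<alpha> \<Longrightarrow> g x \<in> S \<beta>"
    "\<And>x v. x \<in> S \<alpha> \<Longrightarrow> v \<in> worlds M \<Longrightarrow> x \<in> R M v \<alpha> \<Longrightarrow> g x \<in> R M v \<beta>"
    by metis
  obtain f where f: "ResFun f \<in> S (PImp \<alpha> \<beta>)" "fset f = (\<lambda>x. (x, g x)) ` S \<alpha>"
    using S_PImp_graph[of g \<alpha> \<beta>] g(1) by blast
  have "ResFun f \<in> R M v (PImp \<alpha> \<beta>)" if "v \<in> worlds M" for v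
    using f g(2) that by (auto simp del: S.simps)
  then show "sat (Kh (PImp \<alpha> \<beta>)) M w"
    using f(1) unfolding sat.simps by blast
qed

lemma sat_update:
  assumes w: "w \<in> worlds M" "sat (emb \<alpha>) M w"
    and poss: "\<forall>\<beta>\<in>set \<alpha>s. sat (Khat (emb \<alpha> \<^bold>\<and> emb \<beta>)) M w"
  shows "sat (Dia (K (emb \<alpha>) \<^bold>\<and> bigconj (map (\<lambda>\<beta>. Khat (emb \<beta>)) \<alpha>s))) M w"
proof -
  let ?M' = "M\<lparr>worlds := {v \<in> worlds M. sat (emb \<alpha>) M v}\<rparr>"
  have sub: "submodel ?M' M"
    using submodel_restrict[of w M "sat (emb \<alpha>) M"] w by blast
  have emb: "sat (emb \<gamma>) ?M' v \<longleftrightarrow> sat (emb \<gamma>) M v" if "v \<in> worlds ?M'" for \<gamma> v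
    using sat_emb_submodel[OF sub that] .
  have "sat (K (emb \<alpha>)) ?M' w"
    using emb by simp
  moreover have "sat (Khat (emb \<beta>)) ?M' w" if "\<beta> \<in> set \<alpha>s" for \<beta>
    using poss that emb by auto
  ultimately show ?thesis
    unfolding sat_Dia using sub w by (intro exI[of _ ?M']) (auto simp: sat_bigconj)
qed

lemma soundness:
  assumes "\<turnstile> \<phi>" "w \<in> worlds M"
  shows "sat \<phi> M w"
  using assms
\<comment> \<open>Both necessitation rules need the hypothesis elsewhere: \<open>NecK\<close> at
  other worlds of \<open>M\<close>, \<open>NecBox\<close> in submodels.\<close>
proof (induction arbitrary: M w rule: SDELKh.induct)
  case (Taut \<tau> \<sigma>)
  then show ?case by (simp add: sat_subst tautology_def)
next
  case (TBox \<phi>)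
  then show ?case using submodel_refl[OF TBox] by auto
next
  case (FourBox \<phi>)
  then show ?case using submodel_trans by auto
next
  case (KBox \<phi>)
  \<comment> \<open>Every world \<open>v\<close> of a submodel is a world of \<open>M\<close>, so
    \<open>Box\<close> at \<open>v\<close> reaches that same submodel.\<close>
  then show ?case by (auto simp: submodel_def)
next
  case (Per \<alpha>)
  show ?case
    unfolding sat.simps(5,8)
  proof (intro impI allI, elim conjE)
    fix M'
    assume "sat (emb \<alpha>) M w" "submodel M' M" "w \<in> worlds M'"
    then show "sat (emb \<alpha>) M' w"
      by (simp only: sat_emb_submodel[of M' M w])
  qed
next
  case (DiaKh \<alpha>)
  show ?case unfolding sat.simps(5)[of "emb \<alpha>"] by (rule impI) (rule sat_Dia_Kh[OF DiaKh])
next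
  case (KhK \<alpha>)
  show ?case unfolding sat.simps(5) by (rule impI) (rule sat_Kh_imp_K)
next
  case (KhOr \<alpha> \<beta>)
  show ?case
    using sat_Kh_POr[OF KhOr, of \<alpha> \<beta>] unfolding sat.simps(3-5) by blast
next
  case (KhAnd \<alpha> \<beta>)
  show ?case
    using sat_Kh_PAnd[of \<alpha> \<beta> M w] unfolding sat.simps(3-5) by blast
next
  case (KhImp \<alpha> \<beta>)
  show ?case
    using sat_Kh_PImp[OF KhImp, of \<alpha> \<beta>] unfolding sat.simps(3,5) by blast
next
  case (Upd \<alpha> \<alpha>s)
  show ?case (is "sat (?prem \<^bold>\<longrightarrow> ?concl) M w")
    unfolding sat.simps(5)[of ?prem]
  proof
    assume "sat ?prem M w"
    then have "sat (emb \<alpha>) M w" "\<forall>\<beta>\<in>set \<alpha>s. sat (Khat (emb \<alpha> \<^bold>\<and> emb \<beta>)) M w"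
      unfolding sat.simps(3)[of "emb \<alpha>" "bigconj _"] sat_bigconj by auto
    then show "sat ?concl M w"
      by (rule sat_update[OF Upd])
  qed
next
  case (MP \<phi> \<psi>)
  from MP.IH(2)[OF MP.prems] MP.IH(1)[OF MP.prems] show ?case
    by (simp only: sat.simps)
\<comment> \<open>The introspection axioms hold because \<open>K\<close> and \<open>Kh\<close> do
  not depend on the world of evaluation. \<open>Kh PBot\<close> fails since \<open>ResBot\<close>
  resolves nothing at the world \<open>w\<close>.\<close>
qed auto

theorem theorem37:
  fixes \<phi> :: "'p::countable form" and M :: "('w, 'p) model" and w :: 'w
  assumes "\<turnstile> \<phi>" and "is_model M" and "w \<in> worlds M"
  shows "sat \<phi> M w"
  using assms(1,3) by (rule soundness)

end
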